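(* Let $h:\mathbb{R}^m\to\mathbb{R}$ be convex and $L$-Lipschitz and let $c:\mathbb{R}^n\to\mathbb{R}^m$ be $\beta$-smooth, i.e. $\|\nabla c(x_1)-\nabla c(x_2)\|\le\beta\|x_1-x_2\|_2$ for all $x_1,x_2$ ($L,\beta>0$). Let $\varphi=h\circ c$ have a compact local minimizing set $S$, with value $\varphi_\star$ on $S$. Assume there exists $\varepsilon_0>0$ such that in $\mathcal{N}(S,\varepsilon_0)$: (1) $\varphi$ has $\alpha_\varphi$-quadratic growth around $S$ and is norm convex around $S$ with constant $\ell>0$; (2) the prox-linear iterates have the proximity property. Then for $x^0$ sufficiently close to $S$, the iterates $x^k$ of the prox-linear algorithm with stepsize $t=(L\beta)^{-1}$ started at $x^0$ satisfy, for all $k\ge0$, $$\varphi(x^{k+1})-\varphi_\star\le q\,(\varphi(x^k)-\varphi_\star),\qquad q=1-\frac{1}{9+40\ell+100\ell^2L\beta/\alpha_\varphi}.$$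
   Context: $\mathrm{dist}(x,S)=\inf_{y\in S}\|x-y\|_2$, $\mathcal{N}(S,\varepsilon)=\{x:\mathrm{dist}(x,S)\le\varepsilon\}$. $\nabla c(x)\in\mathbb{R}^{n\times m}$ is the transposed Jacobian, and $\partial\varphi(x)=\{\nabla c(x)g:g\in\partial h(c(x))\}$. $S$ is a local minimizing set of $\varphi$ if $\varphi\equiv\varphi_\star$ on $S$ and $\varphi\ge\varphi_\star$ in a neighborhood of $S$. Prox-linear algorithm with stepsize $t>0$: $x^{k+1}=\arg\min_{x\in\mathbb{R}^n}\{\varphi(x^k;x)+\frac{1}{2t}\|x-x^k\|_2^2\}$, where $\varphi(x^k;x)=h\big(c(x^k)+\nabla c(x^k)^\top(x-x^k)\big)$. $\alpha_\varphi$-quadratic growth in $\mathcal{N}(S,\varepsilon_0)$ ($\alpha_\varphi>0$): $\varphi(x)\ge\varphi_\star+\frac{\alpha_\varphi}{2}\mathrm{dist}(x,S)^2$ for all $x\in\mathcal{N}(S,\varepsilon_0)$. Norm convexity with constant $\ell$ in $\mathcal{N}(S,\varepsilon_0)$: $\varphi(x)-\varphi_\star\le\ell\cdot\mathrm{dist}(0,\partial\varphi(x))\cdot\mathrm{dist}(x,S)$ for all $x\in\mathcal{N}(S,\varepsilon_0)$. Proximity property: there is a function $d(\varepsilon)>0$ such that for all $0<\varepsilon\le\varepsilon_0$, whenever $x^0$ lies in the $d(\varepsilon)$-neighborhood of $S$, all prox-linear iterates with $t=(L\beta)^{-1}$ stay in the $\varepsilon$-neighborhood $\mathcal{N}(S,\varepsilon)$.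 *)

theory Defs
  imports "HOL-Analysis.Analysis"
begin

text \<open>
  Throughout, \<open>h\<close> is the outer convex function, \<open>c\<close> the inner smooth map and \<open>h \<circ> c\<close> the composite
  objective. The gradient \<open>grad c x\<close> is the transposed Jacobian, so it is an
  \<open>CARD('n) \<times> CARD('m)\<close> matrix.
\<close>

definition grad :: "(real^'n \<Rightarrow> real^'m) \<Rightarrow> real^'n \<Rightarrow> real^'m^'n" where
  "grad c x = transpose (matrix (frechet_derivative c (at x)))"

text \<open>Matrices are measured in the operator norm induced by the Euclidean norms; \<open>norm\<close> on the
  type \<open>real^'m^'n\<close> would be the Frobenius norm. Differentiability is explicit because
  \<open>frechet_derivative\<close> is total.\<close>

definition smooth_map :: "real \<Rightarrow> (real^'n \<Rightarrow> real^'m) \<Rightarrow> bool" where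
  "smooth_map \<beta> c \<longleftrightarrow>
     (\<forall>x. c differentiable (at x)) \<and>
     (\<forall>x y. onorm ((*v) (grad c x - grad c y)) \<le> \<beta> * norm (x - y))"

definition subdifferential :: "('a::real_inner \<Rightarrow> real) \<Rightarrow> 'a \<Rightarrow> 'a set" where
  "subdifferential h y = {g. \<forall>z. h z \<ge> h y + g \<bullet> (z - y)}"

definition composite_subdifferential ::
    "(real^'m \<Rightarrow> real) \<Rightarrow> (real^'n \<Rightarrow> real^'m) \<Rightarrow> real^'n \<Rightarrow> (real^'n) set" where
  "composite_subdifferential h c x = {grad c x *v g |g. g \<in> subdifferential h (c x)}"

definition nbhd :: "'a::metric_space set \<Rightarrow> real \<Rightarrow> 'a set" where
  "nbhd S \<epsilon> = {x. infdist x S \<le> \<epsilon>}"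

definition local_minimizing_set ::
    "('a::topological_space \<Rightarrow> real) \<Rightarrow> real \<Rightarrow> 'a set \<Rightarrow> bool" where
  "local_minimizing_set \<phi> \<phi>\<^sub>0 S \<longleftrightarrow>
     (\<forall>x\<in>S. \<phi> x = \<phi>\<^sub>0) \<and> (\<exists>U. open U \<and> S \<subseteq> U \<and> (\<forall>x\<in>U. \<phi> x \<ge> \<phi>\<^sub>0))"

definition quadratic_growth ::
    "('a::metric_space \<Rightarrow> real) \<Rightarrow> real \<Rightarrow> 'a set \<Rightarrow> real \<Rightarrow> real \<Rightarrow> bool" where
  "quadratic_growth \<phi> \<phi>\<^sub>0 S \<epsilon>\<^sub>0 \<alpha> \<longleftrightarrow>
     (\<forall>x\<in>nbhd S \<epsilon>\<^sub>0. \<phi> x \<ge> \<phi>\<^sub>0 + \<alpha> / 2 * (infdist x S)\<^sup>2)"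

definition norm_convex ::
    "(real^'m \<Rightarrow> real) \<Rightarrow> (real^'n \<Rightarrow> real^'m) \<Rightarrow> real \<Rightarrow> (real^'n) set \<Rightarrow> real \<Rightarrow> real \<Rightarrow> bool" where
  "norm_convex h c \<phi>\<^sub>0 S \<epsilon>\<^sub>0 l \<longleftrightarrow>
     (\<forall>x\<in>nbhd S \<epsilon>\<^sub>0.
        (h \<circ> c) x - \<phi>\<^sub>0 \<le> l * infdist 0 (composite_subdifferential h c x) * infdist x S)"

definition linearized ::
    "(real^'m \<Rightarrow> real) \<Rightarrow> (real^'n \<Rightarrow> real^'m) \<Rightarrow> real^'n \<Rightarrow> real^'n \<Rightarrow> real" where
  "linearized h c x y = h (c x + transpose (grad c x) *v (y - x))"

text \<open>For convex Lipschitz \<open>h\<close> and \<open>t > 0\<close> the objective below is continuous, coercive and strongly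
  convex, so \<open>ARG_MIN\<close> denotes its unique minimizer.\<close>

definition prox_linear_step ::
    "(real^'m \<Rightarrow> real) \<Rightarrow> (real^'n \<Rightarrow> real^'m) \<Rightarrow> real \<Rightarrow> real^'n \<Rightarrow> real^'n" where
  "prox_linear_step h c t x =
     (ARG_MIN (\<lambda>y. linearized h c x y + 1 / (2 * t) * (norm (y - x))\<^sup>2) y. True)"

primrec prox_linear ::
    "(real^'m \<Rightarrow> real) \<Rightarrow> (real^'n \<Rightarrow> real^'m) \<Rightarrow> real \<Rightarrow> real^'n \<Rightarrow> nat \<Rightarrow> real^'n" where
  "prox_linear h c t x0 0 = x0"
| "prox_linear h c t x0 (Suc k) = prox_linear_step h c t (prox_linear h c t x0 k)"

definition proximity_property ::
    "(real^'m \<Rightarrow> real) \<Rightarrow> (real^'n \<Rightarrow> real^'m) \<Rightarrow> real \<Rightarrow> (real^'n) set \<Rightarrow> real \<Rightarrow> bool" where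
  "proximity_property h c t S \<epsilon>\<^sub>0 \<longleftrightarrow>
     (\<exists>d :: real \<Rightarrow> real. \<forall>\<epsilon>. 0 < \<epsilon> \<and> \<epsilon> \<le> \<epsilon>\<^sub>0 \<longrightarrow>
        d \<epsilon> > 0 \<and> (\<forall>x0\<in>nbhd S (d \<epsilon>). \<forall>k. prox_linear h c t x0 k \<in> nbhd S \<epsilon>))"

end

theory Submission
  imports Defs
begin

text \<open>
  Write \<open>\<mu> = L * \<beta>\<close>, \<open>\<phi> = h \<circ> c\<close>, and let \<open>p\<close> be the prox-linear step from \<open>x\<close> and \<open>r = norm (x - p)\<close>.
  Linearizing \<open>c\<close> costs at most \<open>\<mu>/2 * (norm (y - x))\<^sup>2\<close> in the value of \<open>\<phi>\<close>. Hence the step minimizes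
  a strongly convex majorant of \<open>\<phi>\<close> that is exact at \<open>x\<close>, and it decreases \<open>\<phi>\<close> by at least
  \<open>\<mu>/2 * r\<^sup>2\<close> (\<open>step_decrease\<close>). Linear convergence follows once the optimality gap at \<open>p\<close> is also
  bounded by a multiple of \<open>\<mu> * r\<^sup>2\<close>.

  The step length \<open>r\<close> does not control the subdifferential at \<open>p\<close>, since \<open>h\<close> is not smooth. It does
  control it at a nearby point: the minimizer \<open>z\<close> of \<open>\<phi> y + \<mu> * (norm (y - x))\<^sup>2\<close>, the exact proximal
  point of \<open>x\<close>. That function lies above the model minimized by \<open>p\<close>, its value at \<open>p\<close> exceeds the
  minimum of the model by at most \<open>\<mu> * r\<^sup>2\<close>, and both functions grow quadratically with modulus \<open>\<mu>\<close> around their minimizers;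
  together this gives \<open>norm (z - p) \<le> r\<close>. Optimality of \<open>z\<close> puts \<open>2 * \<mu> * (x - z)\<close> into the
  subdifferential at \<open>z\<close>, a vector of norm at most \<open>4 * \<mu> * r\<close>, and comparison of the models gives
  \<open>\<phi> p \<le> \<phi> z + 4 * \<mu> * r\<^sup>2\<close> (\<open>nearly_stationary_point\<close>).

  At \<open>z\<close> norm convexity bounds the gap by \<open>4 * l * \<mu> * r\<close> times the distance to \<open>S\<close>, and quadratic
  growth bounds that distance by the square root of the gap. Solving for the gap yields
  \<open>\<phi> z - \<phi>\<^sub>0 \<le> 32 * l\<^sup>2 * \<mu>\<^sup>2 * r\<^sup>2 / \<alpha>\<close>, so \<open>\<phi> p - \<phi>\<^sub>0\<close> is at most
  \<open>(8 + 64 * l\<^sup>2 * \<mu> / \<alpha>) * (\<phi> x - \<phi> p)\<close>, which is the contraction with room to spare.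
  The proximity property keeps the iterates so close to \<open>S\<close> that \<open>\<phi>\<close> is nearly \<open>\<phi>\<^sub>0\<close> there. By the
  decrease estimate the steps are then short, so that \<open>z\<close> stays in the region where the growth
  and norm convexity hypotheses apply.
\<close>

section \<open>Minimizers of perturbed convex functions\<close>

lemma le_if_le_add_vanishing:
  fixes a b k :: real
  assumes "\<And>s. 0 < s \<Longrightarrow> s \<le> 1 \<Longrightarrow> a \<le> b + s * k"
  shows "a \<le> b"
proof (rule tendsto_lowerbound)
  show "((\<lambda>s. b + s * k) \<longlongrightarrow> b) (at_right 0)"
    by (auto intro!: tendsto_eq_intros)
  show "\<forall>\<^sub>F s in at_right 0. a \<le> b + s * k"
    using assms by (auto simp: eventually_at_right_field intro!: exI[of _ 1])
qed simp

text \<open>For a convex function, a supporting hyperplane inequality that holds up to a second-order error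
  holds exactly: on a short segment the error is of second order in the length, whereas by convexity
  the increment of the function over the whole segment dominates the rescaled short one.\<close>

lemma convex_supporting_if_up_to_quadratic:
  fixes G :: "'a::real_inner \<Rightarrow> real"
  assumes conv: "convex_on UNIV G"
    and supp: "\<And>u. G q + w \<bullet> u \<le> G (q + u) + \<kappa> * (norm u)\<^sup>2"
  shows "G q + w \<bullet> u \<le> G (q + u)"
proof (rule le_if_le_add_vanishing)
  fix s :: real
  assume s: "0 < s" "s \<le> 1"
  have "G q + w \<bullet> (s *\<^sub>R u) \<le> G (q + s *\<^sub>R u) + \<kappa> * (norm (s *\<^sub>R u))\<^sup>2"
    by (rule supp)
  also have "q + s *\<^sub>R u = (1 - s) *\<^sub>R q + s *\<^sub>R (q + u)"
    by (simp add: algebra_simps)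
  also have "G ((1 - s) *\<^sub>R q + s *\<^sub>R (q + u)) \<le> (1 - s) * G q + s * G (q + u)"
    using convex_onD[OF conv] s by auto
  finally have "s * (G q + w \<bullet> u) \<le> s * (G (q + u) + s * (\<kappa> * (norm u)\<^sup>2))"
    using s by (simp add: algebra_simps power2_eq_square)
  then show "G q + w \<bullet> u \<le> G (q + u) + s * (\<kappa> * (norm u)\<^sup>2)"
    using s by simp
qed

lemma norm_diff_sq_expand:
  fixes p q u :: "'a::real_inner"
  shows "(norm (q + u - p))\<^sup>2 = (norm (q - p))\<^sup>2 + 2 * ((q - p) \<bullet> u) + (norm u)\<^sup>2"
  by (simp add: power2_norm_eq_inner inner_simps inner_commute)

lemma proximal_minimizer_growth:
  fixes G :: "'a::real_inner \<Rightarrow> real"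
  assumes conv: "convex_on UNIV G"
    and min: "\<And>y. G q + \<kappa> / 2 * (norm (q - p))\<^sup>2 \<le> G y + \<kappa> / 2 * (norm (y - p))\<^sup>2"
  shows "G q + \<kappa> / 2 * (norm (q - p))\<^sup>2 + \<kappa> / 2 * (norm (y - q))\<^sup>2
           \<le> G y + \<kappa> / 2 * (norm (y - p))\<^sup>2"
proof -
  have "G q + (\<kappa> *\<^sub>R (p - q)) \<bullet> (y - q) \<le> G (q + (y - q))"
  proof (rule convex_supporting_if_up_to_quadratic[OF conv])
    fix u
    show "G q + (\<kappa> *\<^sub>R (p - q)) \<bullet> u \<le> G (q + u) + \<kappa> / 2 * (norm u)\<^sup>2"
      using min[of "q + u"] by (simp add: norm_diff_sq_expand algebra_simps)
  qed
  moreover have "(\<kappa> *\<^sub>R (p - q)) \<bullet> (y - q) = - (\<kappa> * ((q - p) \<bullet> (y - q)))"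
    by (simp add: algebra_simps)
  moreover have "(norm (y - p))\<^sup>2
      = (norm (q - p))\<^sup>2 + 2 * ((q - p) \<bullet> (y - q)) + (norm (y - q))\<^sup>2"
    using norm_diff_sq_expand[of q "y - q" p] by simp
  ultimately show ?thesis
    by (simp add: distrib_left)
qed

lemma quadratically_coercive_attains_min:
  fixes f :: "'a::euclidean_space \<Rightarrow> real"
  assumes cont: "continuous_on UNIV f" and "\<kappa> > 0"
    and coercive: "\<And>y. a + \<kappa> * (norm (y - p))\<^sup>2 \<le> f y"
  shows "\<exists>q. \<forall>y. f q \<le> f y"
proof -
  define R where "R = sqrt ((f p - a) / \<kappa>)"
  have "a \<le> f p"
    using coercive[of p] by simp
  then have R: "0 \<le> R" "\<kappa> * R\<^sup>2 = f p - a"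
    using \<open>\<kappa> > 0\<close> by (simp_all add: R_def)
  have "\<exists>q\<in>cball p R. \<forall>y\<in>cball p R. f q \<le> f y"
    using R by (intro continuous_attains_inf continuous_on_subset[OF cont]) auto
  then obtain q where q: "\<And>y. y \<in> cball p R \<Longrightarrow> f q \<le> f y"
    by blast
  have "f q \<le> f y" for y
  proof (cases "y \<in> cball p R")
    case False
    then have "R\<^sup>2 \<le> (norm (y - p))\<^sup>2"
      using R by (intro power_mono) (auto simp: dist_norm norm_minus_commute)
    then have "\<kappa> * R\<^sup>2 \<le> \<kappa> * (norm (y - p))\<^sup>2"
      using \<open>\<kappa> > 0\<close> by simp
    then have "f p \<le> f y"
      using coercive[of y] R by linarith
    with q[of p] R show ?thesis by simp
  qed (rule q)
  then show ?thesis by blast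
qed

section \<open>A chain rule for convex subgradients\<close>

lemma inner_transpose_matrix_vector:
  fixes M :: "real^'m^'n"
  shows "e \<bullet> (transpose M *v u) = (M *v e) \<bullet> u"
  by (metis dot_lmul_matrix inner_commute transpose_matrix_vector)

text \<open>This is the Hahn-Banach theorem in disguise: \<open>w\<close> defines on the range of \<open>A\<close> a linear functional
  dominated by the convex function \<open>h (b + z) - h b\<close>, and \<open>g\<close> is a dominated extension. The extension
  comes from a hyperplane separating the graph of that functional from the strict epigraph.\<close>

lemma subgradient_affine_precomposition:
  fixes h :: "real^'m \<Rightarrow> real" and A :: "real^'n^'m"
  assumes conv: "convex_on UNIV h"
    and supp: "\<And>u. h b + w \<bullet> u \<le> h (b + A *v u)"
  shows "\<exists>g\<in>subdifferential h b. w = transpose A *v g"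
proof -
  define T where "T = {(z, s). h (b + z) - h b < s}"
  define D where "D = range (\<lambda>u. (A *v u, w \<bullet> u))"
  have "subspace D"
    unfolding D_def
    by (intro linear_subspace_image subspace_UNIV linearI)
       (simp_all add: matrix_vector_right_distrib inner_add_right
          matrix_vector_mult_scaleR)
  have "h (b + ((1 - v) *\<^sub>R z1 + v *\<^sub>R z2)) - h b < (1 - v) * s1 + v * s2"
    if lt: "h (b + z1) - h b < s1" "h (b + z2) - h b < s2" and v: "0 \<le> v" "v \<le> 1"
    for z1 z2 :: "real^'m" and s1 s2 v :: real
  proof -
    have "b + ((1 - v) *\<^sub>R z1 + v *\<^sub>R z2) = (1 - v) *\<^sub>R (b + z1) + v *\<^sub>R (b + z2)"
      by (simp add: algebra_simps)
    also have "h \<dots> \<le> (1 - v) * h (b + z1) + v * h (b + z2)"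
      using convex_onD[OF conv] v by auto
    also have "\<dots> < (1 - v) * (h b + s1) + v * (h b + s2)"
    proof (cases "v = 0")
      case False
      with lt v show ?thesis
        by (intro add_le_less_mono mult_left_mono mult_strict_left_mono) auto
    qed (use lt in auto)
    finally show ?thesis
      by (simp add: algebra_simps)
  qed
  then have "convex T"
    by (auto simp: convex_alt T_def)
  moreover have "T \<inter> D = {}"
  proof -
    have "(A *v u, w \<bullet> u) \<notin> T" for u
      using supp[of u] by (simp add: T_def)
    then show ?thesis
      by (auto simp: D_def)
  qed
  moreover have "(0, 1) \<in> T"
    by (simp add: T_def)
  moreover have "D \<noteq> {}"
    by (simp add: D_def)
  ultimately obtain a \<eta> where "a \<noteq> 0" and aD: "\<And>d. d \<in> D \<Longrightarrow> a \<bullet> d \<le> \<eta>"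
    and aT: "\<And>d. d \<in> T \<Longrightarrow> \<eta> \<le> a \<bullet> d"
    using separating_hyperplane_sets[of D T] subspace_imp_convex[OF \<open>subspace D\<close>] by blast
  obtain e \<tau> where a: "a = (e, \<tau>)"
    by (cases a)
  have "0 \<le> \<eta>"
    using aD[OF subspace_0[OF \<open>subspace D\<close>]] by simp
  \<comment> \<open>A linear functional bounded above on a subspace vanishes there.\<close>
  have D0: "a \<bullet> d = 0" if "d \<in> D" for d
  proof (rule ccontr)
    assume "a \<bullet> d \<noteq> 0"
    then have "a \<bullet> (((\<eta> + 1) / (a \<bullet> d)) *\<^sub>R d) = \<eta> + 1"
      by simp
    moreover have "((\<eta> + 1) / (a \<bullet> d)) *\<^sub>R d \<in> D"
      using that by (rule subspace_scale[OF \<open>subspace D\<close>])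
    ultimately show False
      using aD by fastforce
  qed
  have T_lower: "0 \<le> e \<bullet> z + \<tau> * s" if "h (b + z) - h b < s" for z s
    using aT[of "(z, s)"] that \<open>0 \<le> \<eta>\<close> by (simp add: a T_def)
  \<comment> \<open>The hyperplane is not vertical because \<open>h\<close> is finite everywhere.\<close>
  have "0 < \<tau>"
  proof (rule ccontr)
    assume "\<not> 0 < \<tau>"
    then have "\<tau> \<le> 0" by simp
    have "0 \<le> e \<bullet> (- e) + \<tau> * (\<bar>h (b - e) - h b\<bar> + 1)"
      by (rule T_lower) simp
    moreover have "\<tau> * (\<bar>h (b - e) - h b\<bar> + 1) \<le> 0"
      using \<open>\<tau> \<le> 0\<close> by (intro mult_nonpos_nonneg) auto
    ultimately have "e \<bullet> e \<le> 0"
      by simp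
    then have "e = 0"
      using inner_ge_zero[of e] by (metis inner_eq_zero_iff order_antisym)
    have "0 \<le> \<tau>"
      using T_lower[of 0 1] by simp
    with \<open>\<tau> \<le> 0\<close> \<open>e = 0\<close> \<open>a \<noteq> 0\<close> show False
      by (simp add: a zero_prod_def)
  qed
  define g where "g = (- 1 / \<tau>) *\<^sub>R e"
  have "h b + g \<bullet> (z - b) \<le> h z" for z
  proof (rule field_le_epsilon)
    fix s :: real
    assume "0 < s"
    have "0 \<le> e \<bullet> (z - b) + \<tau> * (h z - h b + s)"
      by (rule T_lower) (use \<open>0 < s\<close> in simp)
    then have "0 \<le> (e \<bullet> (z - b) + \<tau> * (h z - h b + s)) / \<tau>"
      using \<open>0 < \<tau>\<close> by simp
    then show "h b + g \<bullet> (z - b) \<le> h z + s"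
      using \<open>0 < \<tau>\<close> by (simp add: g_def add_divide_distrib)
  qed
  then have "g \<in> subdifferential h b"
    by (simp add: subdifferential_def)
  moreover have "w \<bullet> u = (transpose A *v g) \<bullet> u" for u
  proof -
    have "e \<bullet> (A *v u) + \<tau> * (w \<bullet> u) = 0"
      using D0[of "(A *v u, w \<bullet> u)"] by (simp add: a D_def)
    then have "w \<bullet> u = g \<bullet> (A *v u)"
      using \<open>0 < \<tau>\<close> by (simp add: g_def field_simps)
    then show ?thesis
      by (simp add: transpose_matrix_vector dot_lmul_matrix)
  qed
  then have "w = transpose A *v g"
    using vector_eq_rdot[of w "transpose A *v g"] by blast
  ultimately show ?thesis by blast
qed

section \<open>The composite model and the prox-linear step\<close>

lemma has_derivative_grad:
  assumes "smooth_map \<beta> c"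
  shows "(c has_derivative (\<lambda>u. transpose (grad c x) *v u)) (at x)"
proof -
  have D: "(c has_derivative frechet_derivative c (at x)) (at x)"
    using assms by (simp add: smooth_map_def frechet_derivative_works)
  then have "(\<lambda>u. transpose (grad c x) *v u) = frechet_derivative c (at x)"
    by (simp add: grad_def matrix_works has_derivative_linear)
  with D show ?thesis by simp
qed

text \<open>The error bound is checked along the segment from \<open>x\<close> to \<open>y\<close>, after pairing the error with
  itself so that only a scalar function has to be differentiated.\<close>

lemma linearization_error:
  fixes c :: "real^'n \<Rightarrow> real^'m"
  assumes smooth: "smooth_map \<beta> c"
  shows "norm (c y - c x - transpose (grad c x) *v (y - x)) \<le> \<beta> / 2 * (norm (y - x))\<^sup>2"
proof -
  define u where "u = y - x"
  define e where "e = c y - c x - transpose (grad c x) *v u"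
  define f where "f s = e \<bullet> c (x + s *\<^sub>R u) - s * (e \<bullet> (transpose (grad c x) *v u))
                          - s\<^sup>2 * (\<beta> / 2 * (norm u)\<^sup>2 * norm e)" for s
  have "f 1 \<le> f 0"
  proof (rule DERIV_nonpos_imp_nonincreasing[where f = f])
    fix s :: real
    assume "0 \<le> s" "s \<le> 1"
    define M where "M = grad c (x + s *\<^sub>R u) - grad c x"
    define f' where "f' = e \<bullet> (transpose (grad c (x + s *\<^sub>R u)) *v u)
                 - e \<bullet> (transpose (grad c x) *v u) - 2 * s * (\<beta> / 2 * (norm u)\<^sup>2 * norm e)"
    have "((\<lambda>s. c (x + s *\<^sub>R u)) has_derivative
            (\<lambda>d. transpose (grad c (x + s *\<^sub>R u)) *v (d *\<^sub>R u))) (at s)"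
      by (rule has_derivative_compose[OF _ has_derivative_grad[OF smooth]])
         (auto intro!: derivative_eq_intros)
    then have "((\<lambda>s. c (x + s *\<^sub>R u)) has_vector_derivative
            (transpose (grad c (x + s *\<^sub>R u)) *v u)) (at s)"
      by (simp add: has_vector_derivative_def matrix_vector_mult_scaleR)
    then have "((\<lambda>s. e \<bullet> c (x + s *\<^sub>R u)) has_real_derivative
            e \<bullet> (transpose (grad c (x + s *\<^sub>R u)) *v u)) (at s)"
      unfolding has_real_derivative_iff_has_vector_derivative
      by (rule bounded_linear.has_vector_derivative[OF bounded_linear_inner_right])
    then have "(f has_real_derivative f') (at s)"
      unfolding f_def f'_def by (auto intro!: derivative_eq_intros)
    moreover have "f' \<le> 0"
    proof -
      have "e \<bullet> (transpose (grad c (x + s *\<^sub>R u)) *v u) - e \<bullet> (transpose (grad c x) *v u)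
              = (M *v e) \<bullet> u"
        by (simp only: M_def inner_transpose_matrix_vector matrix_vector_mult_diff_rdistrib
            inner_diff_left)
      also have "\<dots> \<le> norm (M *v e) * norm u"
        by (rule norm_cauchy_schwarz)
      also have "\<dots> \<le> (\<beta> * norm (s *\<^sub>R u) * norm e) * norm u"
      proof -
        have "norm (M *v e) \<le> onorm ((*v) M) * norm e"
          by (rule onorm) (rule matrix_vector_mul_bounded_linear)
        also have "onorm ((*v) M) \<le> \<beta> * norm (x + s *\<^sub>R u - x)"
          using smooth unfolding smooth_map_def M_def by blast
        finally show ?thesis
          by (simp add: mult_right_mono)
      qed
      finally show ?thesis
        using \<open>0 \<le> s\<close> by (simp add: f'_def power2_eq_square algebra_simps)
    qed
    ultimately show "\<exists>d. (f has_real_derivative d) (at s) \<and> d \<le> 0"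
      by blast
  qed simp
  then have "e \<bullet> e \<le> (\<beta> / 2 * (norm u)\<^sup>2) * norm e"
    by (simp add: f_def u_def e_def inner_diff_right algebra_simps)
  then have "norm e * norm e \<le> (\<beta> / 2 * (norm u)\<^sup>2) * norm e"
    by (simp add: dot_square_norm power2_eq_square)
  moreover have "0 \<le> \<beta> / 2 * (norm u)\<^sup>2" if "e = 0"
  proof -
    have "0 \<le> onorm ((*v) (grad c y - grad c x))"
      by (rule onorm_pos_le) (rule matrix_vector_mul_bounded_linear)
    then have "0 \<le> \<beta> * norm u"
      using smooth unfolding smooth_map_def u_def by (meson order_trans)
    then have "0 \<le> (\<beta> * norm u) * (norm u / 2)"
      by (rule mult_nonneg_nonneg) simp
    then show ?thesis
      by (simp add: power2_eq_square algebra_simps)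
  qed
  ultimately have "norm e \<le> \<beta> / 2 * (norm u)\<^sup>2"
    by (cases "e = 0") (auto simp: mult_le_cancel_right)
  then show ?thesis
    by (simp add: e_def u_def)
qed

locale composite_problem =
  fixes h :: "real^'m \<Rightarrow> real" and c :: "real^'n \<Rightarrow> real^'m" and L \<beta> :: real
  assumes L_pos: "L > 0" and \<beta>_pos: "\<beta> > 0"
    and conv_h: "convex_on UNIV h"
    and lip_h: "L-lipschitz_on UNIV h"
    and smooth_c: "smooth_map \<beta> c"
begin

abbreviation \<mu> :: real where "\<mu> \<equiv> L * \<beta>"

abbreviation \<phi> :: "real^'n \<Rightarrow> real" where "\<phi> \<equiv> h \<circ> c"

abbreviation step :: "real^'n \<Rightarrow> real^'n" where
  "step \<equiv> prox_linear_step h c (inverse \<mu>)"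

lemma \<mu>_pos: "\<mu> > 0"
  using L_pos \<beta>_pos by simp

lemma continuous_objective: "continuous_on UNIV \<phi>"
proof -
  have "continuous_on UNIV c"
    using has_derivative_grad[OF smooth_c]
    by (meson continuous_at_imp_continuous_on has_derivative_continuous)
  then show ?thesis
    by (intro continuous_on_compose continuous_on_subset[OF lipschitz_on_continuous_on[OF lip_h]])
       auto
qed

lemma linearized_at_base [simp]: "linearized h c x x = \<phi> x"
  by (simp add: linearized_def)

lemma
  shows objective_le_model: "\<phi> y \<le> linearized h c x y + \<mu> / 2 * (norm (y - x))\<^sup>2"
    and linearized_le_objective: "linearized h c x y \<le> \<phi> y + \<mu> / 2 * (norm (y - x))\<^sup>2"
proof -
  have "\<bar>\<phi> y - linearized h c x y\<bar>
          \<le> L * dist (c y) (c x + transpose (grad c x) *v (y - x))"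
    using lipschitz_onD[OF lip_h] by (simp add: linearized_def dist_real_def)
  also have "\<dots> \<le> L * (\<beta> / 2 * (norm (y - x))\<^sup>2)"
    using linearization_error[OF smooth_c, of y x] L_pos
    by (intro mult_left_mono) (auto simp: dist_norm algebra_simps)
  finally have "\<bar>\<phi> y - linearized h c x y\<bar> \<le> \<mu> / 2 * (norm (y - x))\<^sup>2"
    by simp
  then show "\<phi> y \<le> linearized h c x y + \<mu> / 2 * (norm (y - x))\<^sup>2"
    and "linearized h c x y \<le> \<phi> y + \<mu> / 2 * (norm (y - x))\<^sup>2"
    unfolding abs_le_iff by linarith+
qed

lemma convex_linearized: "convex_on UNIV (linearized h c x)"
proof (rule convex_onI)
  fix s :: real and y z
  assume s: "0 < s" "s < 1"
  let ?A = "transpose (grad c x)"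
  have "c x + ?A *v ((1 - s) *\<^sub>R y + s *\<^sub>R z - x)
          = (1 - s) *\<^sub>R (c x + ?A *v (y - x)) + s *\<^sub>R (c x + ?A *v (z - x))"
    by (simp add: matrix_vector_mult_diff_distrib matrix_vector_right_distrib
        matrix_vector_mult_scaleR algebra_simps)
  then show "linearized h c x ((1 - s) *\<^sub>R y + s *\<^sub>R z)
               \<le> (1 - s) * linearized h c x y + s * linearized h c x z"
    using convex_onD[OF conv_h, of s] s by (simp add: linearized_def)
qed simp

lemma continuous_linearized: "continuous_on UNIV (linearized h c x)"
  unfolding linearized_def
  by (intro continuous_on_compose2[OF lipschitz_on_continuous_on[OF lip_h]] continuous_on_add
        linear_continuous_on_compose[OF _ matrix_vector_mul_linear] continuous_on_diff
        continuous_on_const continuous_on_id subset_UNIV)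

text \<open>Only the existence of a minimizer needs an argument: the linearized objective decreases at most
  linearly, which the proximal term outweighs.\<close>

lemma step_minimizes:
  "linearized h c x (step x) + \<mu> / 2 * (norm (step x - x))\<^sup>2
     \<le> linearized h c x y + \<mu> / 2 * (norm (y - x))\<^sup>2"
proof -
  let ?F = "\<lambda>y. linearized h c x y + \<mu> / 2 * (norm (y - x))\<^sup>2"
  let ?A = "transpose (grad c x)"
  define K where "K = L * onorm ((*v) ?A)"
  have "(\<phi> x - K\<^sup>2 / \<mu>) + \<mu> / 4 * (norm (y - x))\<^sup>2 \<le> ?F y" for y
  proof -
    define s where "s = norm (y - x)"
    have "\<phi> x - linearized h c x y \<le> L * dist (c x) (c x + ?A *v (y - x))"
      using lipschitz_onD[OF lip_h, of "c x" "c x + ?A *v (y - x)"]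
      by (simp add: linearized_def dist_real_def)
    also have "\<dots> \<le> L * (onorm ((*v) ?A) * norm (y - x))"
      using onorm[OF matrix_vector_mul_bounded_linear, of ?A "y - x"] L_pos
      by (simp add: dist_norm)
    finally have "\<phi> x - linearized h c x y \<le> K * s"
      by (simp add: K_def s_def)
    moreover have "K * s \<le> K\<^sup>2 / \<mu> + \<mu> / 4 * s\<^sup>2"
    proof -
      have "0 \<le> (K - \<mu> / 2 * s)\<^sup>2 / \<mu>"
        using \<mu>_pos by simp
      also have "\<dots> = K\<^sup>2 / \<mu> - K * s + \<mu> / 4 * s\<^sup>2"
        using L_pos \<beta>_pos by (simp add: power2_eq_square field_simps)
      finally show ?thesis by simp
    qed
    ultimately show ?thesis
      by (simp add: s_def field_simps)
  qed
  moreover have "continuous_on UNIV ?F"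
    by (intro continuous_intros continuous_linearized)
  ultimately have "\<exists>q. \<forall>y. ?F q \<le> ?F y"
    using \<mu>_pos by (intro quadratically_coercive_attains_min[of _ "\<mu> / 4"]) auto
  then have "\<exists>q. is_arg_min ?F (\<lambda>_. True) q"
    by (simp add: is_arg_min_linorder)
  then have "is_arg_min ?F (\<lambda>_. True) (arg_min ?F (\<lambda>_. True))"
    unfolding arg_min_def by (rule someI_ex)
  moreover have "arg_min ?F (\<lambda>_. True) = step x"
    by (simp add: prox_linear_step_def field_simps)
  ultimately show ?thesis
    by (simp add: is_arg_min_linorder)
qed

lemma step_growth:
  "linearized h c x (step x) + \<mu> / 2 * (norm (step x - x))\<^sup>2 + \<mu> / 2 * (norm (y - step x))\<^sup>2
     \<le> linearized h c x y + \<mu> / 2 * (norm (y - x))\<^sup>2"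
  by (rule proximal_minimizer_growth[OF convex_linearized step_minimizes])

lemma step_decrease: "\<phi> (step x) + \<mu> / 2 * (norm (step x - x))\<^sup>2 \<le> \<phi> x"
  using step_growth[of x x] objective_le_model[of "step x" x] by (simp add: norm_minus_commute)

text \<open>Replacing \<open>\<phi>\<close> by its linearization at \<open>z\<close> changes it only to second order, so \<open>z\<close> is a
  first-order minimizer of a convex function, for which this is the exact optimality condition.\<close>

lemma proximal_point_supporting:
  assumes "\<And>y. \<phi> z + \<mu> * (norm (z - x))\<^sup>2 \<le> \<phi> y + \<mu> * (norm (y - x))\<^sup>2"
  shows "\<phi> z + (2 * \<mu>) *\<^sub>R (x - z) \<bullet> u \<le> linearized h c z (z + u)"
proof -
  have "linearized h c z z + (2 * \<mu>) *\<^sub>R (x - z) \<bullet> u \<le> linearized h c z (z + u)"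
  proof (rule convex_supporting_if_up_to_quadratic[OF convex_linearized])
    fix u
    have "\<phi> z + \<mu> * (norm (z - x))\<^sup>2 \<le> \<phi> (z + u) + \<mu> * (norm (z + u - x))\<^sup>2"
      by (rule assms)
    moreover have "\<phi> (z + u) \<le> linearized h c z (z + u) + \<mu> / 2 * (norm u)\<^sup>2"
      using objective_le_model[of "z + u" z] by simp
    moreover have "(2 * \<mu>) *\<^sub>R (x - z) \<bullet> u = - (2 * \<mu> * ((z - x) \<bullet> u))"
      by (simp add: algebra_simps)
    ultimately show "linearized h c z z + (2 * \<mu>) *\<^sub>R (x - z) \<bullet> u
                       \<le> linearized h c z (z + u) + (3 / 2 * \<mu>) * (norm u)\<^sup>2"
      by (simp add: norm_diff_sq_expand distrib_left)
  qed
  then show ?thesis by simp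
qed

text \<open>The witness is the exact proximal point of \<open>x\<close> with penalty \<open>\<mu> * (norm (y - x))\<^sup>2\<close>. The weight is
  chosen twice as large as in the step, since half of it pays for the linearization error: the
  proximal objective \<open>Q\<close> is then bounded below by the model \<open>F\<close>, and what remains keeps \<open>Q\<close>
  growing with modulus \<open>\<mu>\<close> although \<open>\<phi>\<close> is not convex.\<close>

lemma nearly_stationary_point:
  "\<exists>z. norm (z - step x) \<le> norm (step x - x)
     \<and> \<phi> (step x) \<le> \<phi> z + 4 * \<mu> * (norm (step x - x))\<^sup>2
     \<and> infdist 0 (composite_subdifferential h c z) \<le> 4 * \<mu> * norm (step x - x)"
proof -
  define p where "p = step x"
  define r where "r = norm (p - x)"
  define F where "F y = linearized h c x y + \<mu> / 2 * (norm (y - x))\<^sup>2" for y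
  define Q where "Q y = \<phi> y + \<mu> * (norm (y - x))\<^sup>2" for y
  have F_growth: "F p + \<mu> / 2 * (norm (y - p))\<^sup>2 \<le> F y" for y
    using step_growth[of x y] by (simp add: F_def p_def)
  have FQ: "F y \<le> Q y" for y
    using linearized_le_objective[of x y] by (simp add: F_def Q_def)
  have "\<exists>z. \<forall>y. Q z \<le> Q y"
  proof (rule quadratically_coercive_attains_min)
    show "continuous_on UNIV Q"
      unfolding Q_def by (intro continuous_on_add continuous_objective continuous_intros)
    show "F p + \<mu> / 2 * (norm (y - p))\<^sup>2 \<le> Q y" for y
      using F_growth[of y] FQ[of y] by linarith
  qed (use \<mu>_pos in simp)
  then obtain z where z: "\<And>y. Q z \<le> Q y"
    by blast
  define w where "w = (2 * \<mu>) *\<^sub>R (x - z)"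
  have supp: "\<phi> z + w \<bullet> u \<le> linearized h c z (z + u)" for u
    unfolding w_def by (rule proximal_point_supporting) (use z in \<open>simp add: Q_def\<close>)
  \<comment> \<open>The affine minorant of the linearization at \<open>z\<close> minorizes \<open>\<phi>\<close> up to \<open>\<mu>/2\<close> times the squared
    distance, so \<open>\<phi>\<close> is weakly convex there.\<close>
  have Q_growth: "Q z + \<mu> / 2 * (norm (p - z))\<^sup>2 \<le> Q p"
  proof -
    have "\<phi> z + w \<bullet> (p - z) \<le> \<phi> p + \<mu> / 2 * (norm (p - z))\<^sup>2"
      using supp[of "p - z"] linearized_le_objective[of z p] by simp
    moreover have "w \<bullet> (p - z) = - (2 * \<mu> * ((z - x) \<bullet> (p - z)))"
      by (simp add: w_def algebra_simps)
    moreover have "(norm (p - x))\<^sup>2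
        = (norm (z - x))\<^sup>2 + 2 * ((z - x) \<bullet> (p - z)) + (norm (p - z))\<^sup>2"
      using norm_diff_sq_expand[of z "p - z" x] by simp
    ultimately show ?thesis
      by (simp add: Q_def distrib_left)
  qed
  have \<phi>_le_F: "\<phi> p \<le> F p"
    using objective_le_model[of p x] by (simp add: F_def)
  have near: "norm (z - p) \<le> r"
  proof -
    have "Q p \<le> F p + \<mu> * r\<^sup>2"
      using \<phi>_le_F by (simp add: Q_def r_def)
    \<comment> \<open>The growth of \<open>F\<close> around \<open>p\<close> and of \<open>Q\<close> around \<open>z\<close> each contribute half of the left side.\<close>
    then have "\<mu> * (norm (z - p))\<^sup>2 \<le> \<mu> * r\<^sup>2"
      using Q_growth F_growth[of z] FQ[of z] by (simp add: norm_minus_commute)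
    then have "(norm (z - p))\<^sup>2 \<le> r\<^sup>2"
      using \<mu>_pos by (simp only: mult_le_cancel_left_pos)
    then show ?thesis
      by (rule power2_le_imp_le) (simp add: r_def)
  qed
  have zx: "norm (z - x) \<le> 2 * r"
    using norm_triangle_ineq[of "z - p" "p - x"] near by (simp add: r_def)
  have "\<phi> p \<le> \<phi> z + \<mu> * (norm (z - x))\<^sup>2"
  proof -
    have "F p \<le> F z"
      using F_growth[of z] \<mu>_pos by (smt (verit) zero_le_power2 mult_nonneg_nonneg half_gt_zero)
    with \<phi>_le_F FQ[of z] show ?thesis
      by (simp add: Q_def)
  qed
  also have "\<dots> \<le> \<phi> z + \<mu> * (2 * r)\<^sup>2"
    using zx \<mu>_pos by (intro add_left_mono mult_left_mono power_mono) auto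
  finally have below_z: "\<phi> p \<le> \<phi> z + 4 * \<mu> * r\<^sup>2"
    by (simp add: power_mult_distrib)
  have "\<exists>g\<in>subdifferential h (c z). w = transpose (transpose (grad c z)) *v g"
    using supp by (intro subgradient_affine_precomposition[OF conv_h]) (simp add: linearized_def)
  then have "w \<in> composite_subdifferential h c z"
    by (auto simp: composite_subdifferential_def)
  then have "infdist 0 (composite_subdifferential h c z) \<le> norm w"
    using infdist_le[of w _ 0] by simp
  also have "norm w = 2 * \<mu> * norm (z - x)"
    using L_pos \<beta>_pos by (simp add: w_def norm_minus_commute)
  also have "\<dots> \<le> 2 * \<mu> * (2 * r)"
    using zx \<mu>_pos by (intro mult_left_mono) auto
  finally have "infdist 0 (composite_subdifferential h c z) \<le> 4 * \<mu> * r"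
    by simp
  with near below_z show ?thesis
    unfolding r_def p_def by blast
qed

end

section \<open>Linear convergence\<close>

text \<open>Norm convexity and quadratic growth combine to a Polyak-Lojasiewicz type inequality: the gap is
  bounded by the squared distance of \<open>0\<close> to the subdifferential.\<close>

lemma gap_le_subgradient_sq:
  assumes "norm_convex h c \<phi>\<^sub>0 S \<epsilon>\<^sub>0 l" and "quadratic_growth (h \<circ> c) \<phi>\<^sub>0 S \<epsilon>\<^sub>0 \<alpha>"
    and "0 < l" "0 < \<alpha>" and "z \<in> nbhd S \<epsilon>\<^sub>0"
    and "infdist 0 (composite_subdifferential h c z) \<le> \<sigma>"
  shows "(h \<circ> c) z - \<phi>\<^sub>0 \<le> 2 * l\<^sup>2 * \<sigma>\<^sup>2 / \<alpha>"
proof -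
  define G where "G = (h \<circ> c) z - \<phi>\<^sub>0"
  define d where "d = infdist z S"
  have growth: "\<alpha> / 2 * d\<^sup>2 \<le> G"
    using assms by (auto simp: quadratic_growth_def G_def d_def)
  have "G \<le> l * infdist 0 (composite_subdifferential h c z) * d"
    using assms by (auto simp: norm_convex_def G_def d_def)
  also have "\<dots> \<le> l * \<sigma> * d"
    using assms by (intro mult_right_mono mult_left_mono) (auto simp: d_def infdist_nonneg)
  finally have "G \<le> (l * \<sigma>) * d"
    by simp
  \<comment> \<open>Young's inequality, with the weight that absorbs half of the gap through quadratic growth.\<close>
  also have "\<dots> \<le> (l * \<sigma>)\<^sup>2 / \<alpha> + \<alpha> / 4 * d\<^sup>2"
  proof -
    have "0 \<le> (l * \<sigma> - \<alpha> / 2 * d)\<^sup>2 / \<alpha>"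
      using \<open>0 < \<alpha>\<close> by simp
    also have "\<dots> = (l * \<sigma>)\<^sup>2 / \<alpha> - (l * \<sigma>) * d + \<alpha> / 4 * d\<^sup>2"
      using \<open>0 < \<alpha>\<close> by (simp add: power2_eq_square field_simps)
    finally show ?thesis by simp
  qed
  also have "\<dots> \<le> (l * \<sigma>)\<^sup>2 / \<alpha> + G / 2"
    using growth by simp
  finally have "G \<le> 2 * ((l * \<sigma>)\<^sup>2 / \<alpha>)"
    by simp
  then show ?thesis
    by (simp add: G_def power_mult_distrib)
qed

lemma small_near_compact:
  fixes f :: "'a::heine_borel \<Rightarrow> real"
  assumes "continuous_on UNIV f" "compact S" "S \<noteq> {}" "\<And>x. x \<in> S \<Longrightarrow> f x < b"
  shows "\<exists>\<epsilon>>0. \<forall>x\<in>nbhd S \<epsilon>. f x < b"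
proof -
  have "open {x. f x < b}"
    using assms(1) by (intro open_Collect_less continuous_on_const) auto
  then obtain e where e: "e > 0" "(\<Union>x\<in>S. cball x e) \<subseteq> {x. f x < b}"
    using compact_subset_open_imp_cball_epsilon_subset[OF \<open>compact S\<close>] assms(4) by blast
  have "f x < b" if x: "x \<in> nbhd S e" for x
  proof -
    obtain y where "y \<in> S" "infdist x S = dist x y"
      using infdist_attains_inf[of S x] assms(2,3) compact_imp_closed by blast
    with x have "x \<in> (\<Union>x\<in>S. cball x e)"
      by (auto simp: nbhd_def dist_commute)
    with e(2) show ?thesis by blast
  qed
  with e(1) show ?thesis by blast
qed

context composite_problem
begin

text \<open>The radius \<open>\<epsilon>\<^sub>0\<close> is split in two halves: one for the distance from the step to \<open>S\<close>, the other for
  the distance from the step to the nearly stationary point, at most \<open>r\<close>. The bound on \<open>\<phi> x\<close> is what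
  makes \<open>r\<close> smaller than \<open>\<epsilon>\<^sub>0 / 2\<close>.\<close>

lemma step_contracts:
  assumes growth: "quadratic_growth \<phi> \<phi>\<^sub>0 S \<epsilon>\<^sub>0 \<alpha>" "\<alpha> > 0"
    and norm_conv: "norm_convex h c \<phi>\<^sub>0 S \<epsilon>\<^sub>0 l" "l > 0"
    and p: "step x \<in> nbhd S (\<epsilon>\<^sub>0 / 2)" and "0 < \<epsilon>\<^sub>0"
    and gap: "\<phi> x < \<phi>\<^sub>0 + \<mu> / 2 * (\<epsilon>\<^sub>0 / 2)\<^sup>2"
  shows "\<phi> (step x) - \<phi>\<^sub>0
           \<le> (1 - 1 / (9 + 40 * l + 100 * l\<^sup>2 * L * \<beta> / \<alpha>)) * (\<phi> x - \<phi>\<^sub>0)"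
proof -
  define r where "r = norm (step x - x)"
  define E where "E = \<phi> (step x) - \<phi>\<^sub>0"
  define N where "N = 9 + 40 * l + 100 * l\<^sup>2 * L * \<beta> / \<alpha>"
  have decrease: "E + \<mu> / 2 * r\<^sup>2 \<le> \<phi> x - \<phi>\<^sub>0"
    using step_decrease[of x] by (simp add: r_def E_def)
  have "step x \<in> nbhd S \<epsilon>\<^sub>0"
    using p \<open>0 < \<epsilon>\<^sub>0\<close> by (simp add: nbhd_def)
  then have "\<phi>\<^sub>0 + \<alpha> / 2 * (infdist (step x) S)\<^sup>2 \<le> \<phi> (step x)"
    using growth unfolding quadratic_growth_def by blast
  moreover have "0 \<le> \<alpha> / 2 * (infdist (step x) S)\<^sup>2"
    using growth by simp
  ultimately have "0 \<le> E"
    by (simp add: E_def)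
  then have "\<mu> / 2 * r\<^sup>2 < \<mu> / 2 * (\<epsilon>\<^sub>0 / 2)\<^sup>2"
    using gap decrease by linarith
  then have "r\<^sup>2 < (\<epsilon>\<^sub>0 / 2)\<^sup>2"
    using \<mu>_pos by (simp only: mult_less_cancel_left_pos half_gt_zero)
  then have "r < \<epsilon>\<^sub>0 / 2"
    by (rule power2_less_imp_less) (use \<open>0 < \<epsilon>\<^sub>0\<close> in simp)
  obtain z where z: "norm (z - step x) \<le> r" "\<phi> (step x) \<le> \<phi> z + 4 * \<mu> * r\<^sup>2"
    "infdist 0 (composite_subdifferential h c z) \<le> 4 * \<mu> * r"
    using nearly_stationary_point[of x] by (auto simp: r_def)
  have "z \<in> nbhd S \<epsilon>\<^sub>0"
    using infdist_triangle[of z S "step x"] p z(1) \<open>r < \<epsilon>\<^sub>0 / 2\<close>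
    by (simp add: nbhd_def dist_norm)
  then have "\<phi> z - \<phi>\<^sub>0 \<le> 2 * l\<^sup>2 * (4 * \<mu> * r)\<^sup>2 / \<alpha>"
    using gap_le_subgradient_sq growth norm_conv z(3) by blast
  then have "E \<le> (8 + 64 * l\<^sup>2 * L * \<beta> / \<alpha>) * (\<mu> / 2 * r\<^sup>2)"
    using z(2) by (simp add: E_def power2_eq_square algebra_simps)
  also have "\<dots> \<le> (N - 1) * (\<phi> x - \<phi>\<^sub>0 - E)"
  proof (rule mult_mono)
    have "64 * (l\<^sup>2 * L * \<beta> / \<alpha>) \<le> 100 * (l\<^sup>2 * L * \<beta> / \<alpha>)"
      using L_pos \<beta>_pos growth(2) by (intro mult_right_mono) auto
    then show "8 + 64 * l\<^sup>2 * L * \<beta> / \<alpha> \<le> N - 1"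
      using norm_conv(2) by (simp add: N_def mult.assoc)
    have "0 \<le> 100 * l\<^sup>2 * L * \<beta> / \<alpha>"
      using L_pos \<beta>_pos growth(2) by simp
    then show "0 \<le> N - 1"
      using norm_conv(2) by (simp add: N_def)
  qed (use decrease \<mu>_pos in auto)
  finally have "E * N \<le> (N - 1) * (\<phi> x - \<phi>\<^sub>0)"
    by (simp add: algebra_simps)
  moreover have "0 < N"
    using L_pos \<beta>_pos growth(2) norm_conv(2) by (auto simp: N_def intro!: add_pos_nonneg)
  ultimately have "E \<le> (1 - 1 / N) * (\<phi> x - \<phi>\<^sub>0)"
    by (simp add: field_simps)
  then show ?thesis
    by (simp add: E_def N_def)
qed

end

theorem theorem2:
  fixes h :: "real^'m \<Rightarrow> real"
    and c :: "real^'n \<Rightarrow> real^'m"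
    and L \<beta> \<alpha> l \<epsilon>\<^sub>0 \<phi>\<^sub>0 :: real
    and S :: "(real^'n) set"
  assumes "L > 0" and "\<beta> > 0"
    and "convex_on UNIV h"
    and "L-lipschitz_on UNIV h"
    and "smooth_map \<beta> c"
    and "compact S" and "S \<noteq> {}"
    and "local_minimizing_set (h \<circ> c) \<phi>\<^sub>0 S"
    and "\<epsilon>\<^sub>0 > 0"
    and "\<alpha> > 0" and "quadratic_growth (h \<circ> c) \<phi>\<^sub>0 S \<epsilon>\<^sub>0 \<alpha>"
    and "l > 0" and "norm_convex h c \<phi>\<^sub>0 S \<epsilon>\<^sub>0 l"
    and "proximity_property h c (inverse (L * \<beta>)) S \<epsilon>\<^sub>0"
  shows "\<exists>\<delta>>0. \<forall>x0\<in>nbhd S \<delta>. \<forall>k.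
           (h \<circ> c) (prox_linear h c (inverse (L * \<beta>)) x0 (Suc k)) - \<phi>\<^sub>0
             \<le> (1 - 1 / (9 + 40 * l + 100 * l\<^sup>2 * L * \<beta> / \<alpha>))
                * ((h \<circ> c) (prox_linear h c (inverse (L * \<beta>)) x0 k) - \<phi>\<^sub>0)"
proof -
  interpret composite_problem h c L \<beta>
    using assms by unfold_locales
  have value_on_S: "\<phi> x = \<phi>\<^sub>0" if "x \<in> S" for x
    using assms(8) that by (simp add: local_minimizing_set_def)
  have "\<exists>\<epsilon>>0. \<forall>x\<in>nbhd S \<epsilon>. \<phi> x < \<phi>\<^sub>0 + \<mu> / 2 * (\<epsilon>\<^sub>0 / 2)\<^sup>2"
    by (rule small_near_compact[OF continuous_objective \<open>compact S\<close> \<open>S \<noteq> {}\<close>])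
       (use value_on_S \<mu>_pos \<open>\<epsilon>\<^sub>0 > 0\<close> in auto)
  then obtain \<epsilon>1 where \<epsilon>1: "\<epsilon>1 > 0"
      "\<And>x. x \<in> nbhd S \<epsilon>1 \<Longrightarrow> \<phi> x < \<phi>\<^sub>0 + \<mu> / 2 * (\<epsilon>\<^sub>0 / 2)\<^sup>2"
    by blast
  define \<epsilon> where "\<epsilon> = min \<epsilon>1 (\<epsilon>\<^sub>0 / 2)"
  have \<epsilon>: "0 < \<epsilon>" "\<epsilon> \<le> \<epsilon>\<^sub>0" "nbhd S \<epsilon> \<subseteq> nbhd S \<epsilon>1" "nbhd S \<epsilon> \<subseteq> nbhd S (\<epsilon>\<^sub>0 / 2)"
    using \<epsilon>1(1) \<open>\<epsilon>\<^sub>0 > 0\<close> by (auto simp: \<epsilon>_def nbhd_def)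
  obtain \<delta> where "\<delta> > 0"
    and stay: "\<And>x0 k. x0 \<in> nbhd S \<delta> \<Longrightarrow> prox_linear h c (inverse \<mu>) x0 k \<in> nbhd S \<epsilon>"
    using \<open>proximity_property h c (inverse \<mu>) S \<epsilon>\<^sub>0\<close> \<epsilon>(1,2)
    unfolding proximity_property_def by metis
  have "\<phi> (prox_linear h c (inverse \<mu>) x0 (Suc k)) - \<phi>\<^sub>0
          \<le> (1 - 1 / (9 + 40 * l + 100 * l\<^sup>2 * L * \<beta> / \<alpha>))
             * (\<phi> (prox_linear h c (inverse \<mu>) x0 k) - \<phi>\<^sub>0)"
    if "x0 \<in> nbhd S \<delta>" for x0 k
  proof -
    let ?x = "prox_linear h c (inverse \<mu>) x0 k"
    have "step ?x \<in> nbhd S (\<epsilon>\<^sub>0 / 2)"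
      using stay[OF that, of "Suc k"] \<epsilon>(4) by auto
    moreover have "\<phi> ?x < \<phi>\<^sub>0 + \<mu> / 2 * (\<epsilon>\<^sub>0 / 2)\<^sup>2"
      using stay[OF that, of k] \<epsilon>(3) by (intro \<epsilon>1(2)) auto
    ultimately show ?thesis
      unfolding prox_linear.simps
      by (intro step_contracts) (use assms in auto)
  qed
  with \<open>\<delta> > 0\<close> show ?thesis by blast
qed

end
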